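(* Let $n$ and $r$ be positive integers with $n<r$. Then $$|B_u(n,r)| \;\ge\; \frac{1}{n!}\,Z_{S_r}(2^n,2^n,\ldots,2^n)\;\ge\;\frac{\binom{r+2^n-1}{r}}{n!}.$$
   Context: Let $I$ and $O$ be disjoint sets of vertices with $|I|=n$ and $|O|=r$. An $(n,r)$-bipartite graph is a triple $(I,O,E)$ in which each edge in $E$ connects a vertex of $I$ with a vertex of $O$, i.e. $E\subseteq I\times O$ (so there are $2^{nr}$ of them). Two such graphs $(I,O,E_1)$ and $(I,O,E_2)$ are isomorphic if there are bijections $\alpha:I\to I$ and $\beta:O\to O$ such that for all $v_1\in I$, $v_2\in O$: $(\alpha(v_1),\beta(v_2))\in E_2$ if and only if $(v_1,v_2)\in E_1$. $B_u(n,r)$ denotes a set containing exactly one $(n,r)$-bipartite graph from each isomorphism class, so $|B_u(n,r)|$ is the number of isomorphism classes (equivalently, the number of $n\times r$ binary matrices up to row and column permutations). The cycle index polynomial of the symmetric group $S_r$ is $Z_{S_r}(x_1,\ldots,x_r)=\frac{1}{r!}\sum_{\sigma\in S_r}\prod_{j=1}^r x_j^{q_j(\sigma)}$, where $q_j(\sigma)$ is the number of cycles of length $j$ (fixed points included) in the disjoint cycle decomposition of $\sigma$. *)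

theory Defs
  imports Complex_Main "HOL-Combinatorics.Orbits"
begin

type_synonym 'a bip_graph = "'a set \<times> 'a set \<times> ('a \<times> 'a) set"

definition bip_graphs :: "'a set \<Rightarrow> 'a set \<Rightarrow> 'a bip_graph set" where
  "bip_graphs I W = {(I, W, E) | E. E \<subseteq> I \<times> W}"

text \<open>Isomorphisms preserve the two sides of the bipartition, which are fixed.\<close>

fun bip_iso :: "'a bip_graph \<Rightarrow> 'a bip_graph \<Rightarrow> bool" where
  "bip_iso (I, W, E1) (I', W', E2) \<longleftrightarrow>
     I' = I \<and> W' = W \<and>
     (\<exists>\<alpha> \<beta>. bij_betw \<alpha> I I \<and> bij_betw \<beta> W W \<and>
        (\<forall>v1\<in>I. \<forall>v2\<in>W. (\<alpha> v1, \<beta> v2) \<in> E2 \<longleftrightarrow> (v1, v2) \<in> E1))"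

definition iso_representatives :: "'a set \<Rightarrow> 'a set \<Rightarrow> 'a bip_graph set \<Rightarrow> bool" where
  "iso_representatives I W B \<longleftrightarrow>
     B \<subseteq> bip_graphs I W \<and> (\<forall>G \<in> bip_graphs I W. \<exists>!H. H \<in> B \<and> bip_iso G H)"

text \<open>The cycles of a permutation \<open>p\<close> of \<open>A\<close> are identified with their underlying sets, the
  orbits of \<open>p\<close> in \<open>A\<close>; a fixed point \<open>x\<close> gives the orbit \<open>{x}\<close> of size 1.\<close>

definition cycle_count :: "'a set \<Rightarrow> ('a \<Rightarrow> 'a) \<Rightarrow> nat \<Rightarrow> nat" where
  "cycle_count A p j = card {C. C \<subseteq> A \<and> cyclic_on p C \<and> card C = j}"

text \<open>The value at \<open>x 1, \<dots>, x r\<close> of the cycle index polynomial of the symmetric group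
  on \<open>{1..r}\<close>.\<close>

definition cycle_index_sym :: "nat \<Rightarrow> (nat \<Rightarrow> 'a::field_char_0) \<Rightarrow> 'a" where
  "cycle_index_sym r x =
     1 / fact r * (\<Sum>\<sigma> | \<sigma> permutes {1..r}. \<Prod>j = 1..r. x j ^ cycle_count {1..r} \<sigma> j)"

lemma bip_iso_refl: "bip_iso G G"
  by (cases G) (auto intro!: exI[of _ id])

lemma bip_iso_sym:
  assumes "bip_iso G H"
  shows "bip_iso H G"
proof -
  obtain I W E1 E2 \<alpha> \<beta> where GH: "G = (I, W, E1)" "H = (I, W, E2)"
    and a: "bij_betw \<alpha> I I" and b: "bij_betw \<beta> W W"
    and e: "\<forall>v1\<in>I. \<forall>v2\<in>W. (\<alpha> v1, \<beta> v2) \<in> E2 \<longleftrightarrow> (v1, v2) \<in> E1"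
    using assms by (cases G; cases H) auto
  let ?a = "inv_into I \<alpha>" and ?b = "inv_into W \<beta>"
  have "(?a v1, ?b v2) \<in> E1 \<longleftrightarrow> (v1, v2) \<in> E2" if "v1 \<in> I" "v2 \<in> W" for v1 v2
  proof -
    have "?a v1 \<in> I" "?b v2 \<in> W"
      using that a b by (metis bij_betw_def inv_into_into)+
    moreover have "\<alpha> (?a v1) = v1" "\<beta> (?b v2) = v2"
      using that a b by (simp_all add: bij_betw_inv_into_right)
    ultimately show ?thesis using e by metis
  qed
  then show ?thesis
    using bij_betw_inv_into[OF a] bij_betw_inv_into[OF b] GH by auto
qed

lemma bip_iso_trans:
  assumes "bip_iso G H" "bip_iso H K"
  shows "bip_iso G K"
proof -
  obtain I W E1 E2 E3 \<alpha> \<beta> \<gamma> \<delta>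
    where GHK: "G = (I, W, E1)" "H = (I, W, E2)" "K = (I, W, E3)"
    and a: "bij_betw \<alpha> I I" and b: "bij_betw \<beta> W W"
    and c: "bij_betw \<gamma> I I" and d: "bij_betw \<delta> W W"
    and e1: "\<forall>v1\<in>I. \<forall>v2\<in>W. (\<alpha> v1, \<beta> v2) \<in> E2 \<longleftrightarrow> (v1, v2) \<in> E1"
    and e2: "\<forall>v1\<in>I. \<forall>v2\<in>W. (\<gamma> v1, \<delta> v2) \<in> E3 \<longleftrightarrow> (v1, v2) \<in> E2"
    using assms by (cases G; cases H; cases K) auto
  have "((\<gamma> \<circ> \<alpha>) v1, (\<delta> \<circ> \<beta>) v2) \<in> E3 \<longleftrightarrow> (v1, v2) \<in> E1" if "v1 \<in> I" "v2 \<in> W" for v1 v2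
    using that e1 e2 bij_betwE[OF a] bij_betwE[OF b] by simp
  then show ?thesis
    using bij_betw_trans[OF a c] bij_betw_trans[OF b d] GHK
    by (simp only: bip_iso.simps) blast
qed

lemma iso_representatives_exists: "\<exists>B. iso_representatives I W B"
proof -
  define c where "c G = (SOME H. H \<in> bip_graphs I W \<and> bip_iso G H)" for G :: "'a bip_graph"
  have c: "c G \<in> bip_graphs I W \<and> bip_iso G (c G)" if "G \<in> bip_graphs I W" for G
    unfolding c_def by (rule someI[of _ G]) (use that bip_iso_refl in blast)
  have eq: "c G = c H" if "bip_iso G H" for G H
  proof -
    have "bip_iso G K \<longleftrightarrow> bip_iso H K" for K
      using that by (metis bip_iso_sym bip_iso_trans)
    then show ?thesis by (simp add: c_def)
  qed
  have "\<exists>!H. H \<in> c ` bip_graphs I W \<and> bip_iso G H" if "G \<in> bip_graphs I W" for G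
  proof (rule ex1I[where a="c G"])
    show "c G \<in> c ` bip_graphs I W \<and> bip_iso G (c G)" using c that by blast
    fix H assume H: "H \<in> c ` bip_graphs I W \<and> bip_iso G H"
    then obtain K where K: "K \<in> bip_graphs I W" "H = c K" by blast
    then have "bip_iso G K" using H c[OF K(1)] by (metis bip_iso_sym bip_iso_trans)
    then show "H = c G" using eq K by simp
  qed
  moreover have "c ` bip_graphs I W \<subseteq> bip_graphs I W" using c by blast
  ultimately have "iso_representatives I W (c ` bip_graphs I W)"
    by (simp add: iso_representatives_def)
  then show ?thesis ..
qed

end

theory Submission
  imports Defs
begin

text \<open>A graph is determined, up to permutations of the vertices in \<open>W\<close>, by the multiset of
  the neighbourhoods of these vertices, which is an arbitrary multiset of \<open>r\<close> subsets of \<open>I\<close>.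
  An isomorphism of graphs acts on these multisets through its permutation \<open>\<alpha>\<close> of \<open>I\<close> alone.
  An isomorphism class therefore accounts for at most \<open>n!\<close> multisets, one for each \<open>\<alpha>\<close>, and
  every multiset arises; hence \<open>n!\<close> times the number of classes is at least the number of multisets,
  the binomial coefficient \<open>(r + 2^n - 1) choose r\<close>
  (lemma \<open>card_multisets_le_representatives\<close>).

  The cycle index with all variables equal to \<open>k\<close> is exactly \<open>(r + k - 1) choose r\<close>
  (lemma \<open>cycle_index_sym_const\<close>), so the second inequality is an equality and the first is
  the bound above. To evaluate the cycle index, read \<open>k\<close> to the number of cycles of \<open>p\<close> as
  the number of colourings of the points with \<open>k\<close> colours that are constant on the cycles, that is,
  invariant under \<open>p\<close> (lemma \<open>card_invariant_colourings\<close>). In this form the sum over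
  all permutations satisfies a simple recursion. Each permutation of \<open>insert a A\<close> is obtained from
  one of \<open>A\<close> either by adding the fixed point \<open>a\<close>, whose colour is free, or by inserting \<open>a\<close> into a
  cycle in front of one of the points of \<open>A\<close>, which forces its colour. So each new point multiplies the
  sum by \<open>k + |A|\<close>, and the result is the rising factorial of \<open>k\<close>
  (lemma \<open>sum_card_invariant_colourings\<close>).\<close>

section \<open>The cycle index at a constant\<close>

definition invariant_colourings :: "'a set \<Rightarrow> ('a \<Rightarrow> 'a) \<Rightarrow> 'c set \<Rightarrow> ('a \<Rightarrow> 'c) set" where
  "invariant_colourings A p K = {f \<in> A \<rightarrow>\<^sub>E K. \<forall>x\<in>A. f (p x) = f x}"

definition cycles :: "'a set \<Rightarrow> ('a \<Rightarrow> 'a) \<Rightarrow> 'a set set" where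
  "cycles A p = {C. C \<subseteq> A \<and> cyclic_on p C}"

text \<open>The product in the cycle index depends only on the total number of cycles once all variables
  agree; this lemma supplies the exponent.\<close>

lemma card_cycles_eq_sum_cycle_count:
  assumes "card A = r" "finite A"
  shows "card (cycles A p) = (\<Sum>j = 1..r. cycle_count A p j)"
proof -
  have "card C \<in> {1..r}" if "C \<in> cycles A p" for C
    using that assms card_mono[of A C] finite_subset[of C A]
    by (auto simp: cycles_def cyclic_on_alldef Suc_le_eq card_gt_0_iff)
  then have "cycles A p = (\<Union>j\<in>{1..r}. {C. C \<subseteq> A \<and> cyclic_on p C \<and> card C = j})"
    by (auto simp: cycles_def)
  also have "card \<dots> = (\<Sum>j = 1..r. cycle_count A p j)"
    unfolding cycle_count_def
    by (rule card_UN_disjoint) (use assms(2) in auto)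
  finally show ?thesis .
qed

lemma orbit_permutes_image:
  assumes "p permutes A" "finite A"
  shows "orbit p (p x) = orbit p x"
proof -
  have "permutation p" using assms by (auto simp: permutation_permutes)
  then show ?thesis
    using cyclic_on_orbit'[of p x] orbit.base[of p x] unfolding cyclic_on_alldef by blast
qed

text \<open>An invariant colouring is constant on each cycle, and the cycles partition the ground set, so
  invariant colourings correspond to arbitrary colourings of the set of cycles.\<close>

lemma card_invariant_colourings:
  assumes p: "p permutes A" and A: "finite A"
  shows "card (invariant_colourings A p K) = card K ^ card (cycles A p)"
proof -
  have perm: "permutation p" using p A by (auto simp: permutation_permutes)
  have orb_cycle: "orbit p x \<in> cycles A p" if "x \<in> A" for x
    using permutes_orbit_subset[OF p that] cyclic_on_orbit'[OF perm, of x] by (simp add: cycles_def)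
  have cycle_orb: "C = orbit p x" if "C \<in> cycles A p" "x \<in> C" for C x
    using that by (auto simp: cycles_def cyclic_on_alldef)
  have const: "f y = f x" if "f \<in> invariant_colourings A p K" "x \<in> A" "y \<in> orbit p x" for f x y
    using that(3)
  proof induction
    case base
    then show ?case using that by (simp add: invariant_colourings_def)
  next
    case (step y)
    then have "y \<in> A" using permutes_orbit_subset[OF p that(2)] by auto
    then show ?case using that step by (simp add: invariant_colourings_def)
  qed
  have pick: "(SOME y. y \<in> C) \<in> C" if "C \<in> cycles A p" for C
    using that by (auto simp: cycles_def cyclic_on_alldef some_in_eq)
  have pick_A: "(SOME y. y \<in> C) \<in> A" if "C \<in> cycles A p" for C
    using pick[OF that] that by (auto simp: cycles_def)
  (* One point per cycle is enough to read off the colour of the cycle. *)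
  have "bij_betw (\<lambda>f. \<lambda>C\<in>cycles A p. f (SOME y. y \<in> C))
      (invariant_colourings A p K) (cycles A p \<rightarrow>\<^sub>E K)"
  proof (rule bij_betw_byWitness[where f' = "\<lambda>g. \<lambda>x\<in>A. g (orbit p x)"])
    show "\<forall>f\<in>invariant_colourings A p K.
        (\<lambda>x\<in>A. (\<lambda>C\<in>cycles A p. f (SOME y. y \<in> C)) (orbit p x)) = f"
    proof
      fix f assume f: "f \<in> invariant_colourings A p K"
      show "(\<lambda>x\<in>A. (\<lambda>C\<in>cycles A p. f (SOME y. y \<in> C)) (orbit p x)) = f"
      proof (rule extensionalityI[of _ A])
        show "f \<in> extensional A" using f by (auto simp: invariant_colourings_def PiE_def)
      qed (use const[OF f] orb_cycle pick in auto)
    qed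
    show "\<forall>g\<in>cycles A p \<rightarrow>\<^sub>E K.
        (\<lambda>C\<in>cycles A p. (\<lambda>x\<in>A. g (orbit p x)) (SOME y. y \<in> C)) = g"
    proof
      fix g assume g: "g \<in> cycles A p \<rightarrow>\<^sub>E K"
      show "(\<lambda>C\<in>cycles A p. (\<lambda>x\<in>A. g (orbit p x)) (SOME y. y \<in> C)) = g"
      proof (rule extensionalityI[of _ "cycles A p"])
        show "g \<in> extensional (cycles A p)" using g by (auto simp: PiE_def)
        fix C assume C: "C \<in> cycles A p"
        show "(\<lambda>C\<in>cycles A p. (\<lambda>x\<in>A. g (orbit p x)) (SOME y. y \<in> C)) C = g C"
          using C pick_A[OF C] cycle_orb[OF C pick[OF C]] by simp
      qed simp
    qed
    show "(\<lambda>f. \<lambda>C\<in>cycles A p. f (SOME y. y \<in> C)) ` invariant_colourings A p K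
        \<subseteq> cycles A p \<rightarrow>\<^sub>E K"
    proof (intro image_subsetI PiE_I)
      fix f C assume "f \<in> invariant_colourings A p K" "C \<in> cycles A p"
      then show "(\<lambda>C\<in>cycles A p. f (SOME y. y \<in> C)) C \<in> K"
        using pick_A[of C] by (auto simp: invariant_colourings_def dest: PiE_mem)
    qed simp
    show "(\<lambda>g. \<lambda>x\<in>A. g (orbit p x)) ` (cycles A p \<rightarrow>\<^sub>E K) \<subseteq> invariant_colourings A p K"
      using orb_cycle permutes_in_image[OF p] orbit_permutes_image[OF p A]
      by (auto simp: invariant_colourings_def)
  qed
  then have "card (invariant_colourings A p K) = card (cycles A p \<rightarrow>\<^sub>E K)"
    by (rule bij_betw_same_card)
  also have "\<dots> = card K ^ card (cycles A p)"
    by (rule card_funcsetE) (use A in \<open>simp add: cycles_def\<close>)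
  finally show ?thesis .
qed

text \<open>For \<open>b \<noteq> a\<close>, the permutation \<open>transpose a b \<circ> p\<close> maps the point that \<open>p\<close> sends to \<open>b\<close> to
  \<open>a\<close> instead, and \<open>a\<close> to \<open>b\<close>: the new point is inserted in front of \<open>b\<close> in its cycle. Its colour
  must then be that of \<open>b\<close>, and no other condition on the colouring changes. For \<open>b = a\<close>, the new
  point is fixed and its colour is free.\<close>

lemma invariant_colourings_insert:
  assumes p: "p permutes A" and a: "a \<notin> A" and b: "b \<in> insert a A"
  shows "invariant_colourings (insert a A) (transpose a b \<circ> p) K =
    (\<lambda>(c, f). f(a := c)) ` {(c, f). c \<in> K \<and> f \<in> invariant_colourings A p K \<and> (b = a \<or> c = f b)}"
    (is "?L = ?h ` ?S")
proof -
  have pa: "p a = a" using permutes_not_in[OF p a] .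
  have pA: "p x \<in> A" if "x \<in> A" for x using that permutes_in_image[OF p] by simp
  have key: "(\<forall>x\<in>insert a A. (f(a := c)) ((transpose a b \<circ> p) x) = (f(a := c)) x) \<longleftrightarrow>
      (\<forall>x\<in>A. f (p x) = f x) \<and> (b = a \<or> c = f b)" for f :: "'a \<Rightarrow> 'b" and c
  proof (cases "b = a")
    case True
    have "p x \<noteq> a" "x \<noteq> a" if "x \<in> A" for x using that pA a by auto
    then show ?thesis using True pa by auto
  next
    case False
    have ne: "p x \<noteq> a" "x \<noteq> a" if "x \<in> A" for x using that pA a by auto
    have at_a: "(f(a := c)) ((transpose a b \<circ> p) a) = f b"
      using False pa by simp
    show ?thesis
    proof (cases "c = f b")
      case c: True
      have "(f(a := c)) ((transpose a b \<circ> p) x) = f (p x)" if "x \<in> A" for x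
        using ne[OF that] c False by (auto simp: transpose_def)
      then show ?thesis using at_a c ne False by simp
    next
      case c: False
      then show ?thesis using at_a False by (metis fun_upd_same insertI1)
    qed
  qed
  show ?thesis
  proof (intro equalityI subsetI)
    fix g assume g: "g \<in> ?L"
    then obtain c f where cf: "c \<in> K" "f \<in> A \<rightarrow>\<^sub>E K" "g = f(a := c)"
      by (auto simp: invariant_colourings_def PiE_insert_eq)
    with g have "(c, f) \<in> ?S"
      using key[of f c] by (simp add: invariant_colourings_def)
    with cf show "g \<in> ?h ` ?S" by force
  next
    fix g assume "g \<in> ?h ` ?S"
    then obtain c f where cf: "(c, f) \<in> ?S" "g = f(a := c)" by auto
    then have "g \<in> insert a A \<rightarrow>\<^sub>E K"
      by (auto simp: invariant_colourings_def PiE_insert_eq)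
    then show "g \<in> ?L"
      using cf key[of f c] by (simp add: invariant_colourings_def)
  qed
qed

lemma card_invariant_colourings_insert:
  assumes p: "p permutes A" and A: "finite A" and a: "a \<notin> A" and b: "b \<in> insert a A"
  shows "card (invariant_colourings (insert a A) (transpose a b \<circ> p) K) =
    (if b = a then card K else 1) * card (invariant_colourings A p K)"
proof -
  let ?X = "invariant_colourings A p K"
  let ?S = "{(c, f). c \<in> K \<and> f \<in> ?X \<and> (b = a \<or> c = f b)}"
  have "inj_on (\<lambda>(c, f). f(a := c)) (K \<times> (A \<rightarrow>\<^sub>E K))"
    using inj_combinator[OF a, of "\<lambda>_. K"] by simp
  then have "inj_on (\<lambda>(c, f). f(a := c)) ?S"
    by (rule inj_on_subset) (auto simp: invariant_colourings_def)
  then have "card (invariant_colourings (insert a A) (transpose a b \<circ> p) K) = card ?S"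
    unfolding invariant_colourings_insert[OF p a b] by (rule card_image)
  also have "\<dots> = (if b = a then card K else 1) * card ?X"
  proof (cases "b = a")
    case True
    then have "?S = K \<times> ?X" by auto
    then show ?thesis using True by (simp add: card_cartesian_product)
  next
    case False
    then have "b \<in> A" using b by simp
    then have "?S = (\<lambda>f. (f b, f)) ` ?X"
      using False by (auto simp: invariant_colourings_def)
    moreover have "inj_on (\<lambda>f. (f b, f)) ?X" by (auto simp: inj_on_def)
    ultimately show ?thesis using False by (simp add: card_image)
  qed
  finally show ?thesis .
qed

text \<open>With \<open>card_invariant_colourings\<close>, this is the generating function of the unsigned Stirling
  numbers of the first kind, evaluated at \<open>card K\<close>. Counting colourings instead of summing powers
  avoids following the cycles themselves when a point is inserted.\<close>

lemma sum_card_invariant_colourings: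
  assumes "finite A"
  shows "(\<Sum>p | p permutes A. card (invariant_colourings A p K)) = pochhammer (card K) (card A)"
  using assms
proof (induction A rule: finite_induct)
  case empty
  have "invariant_colourings {} p K = {\<lambda>_. undefined}" for p :: "'a \<Rightarrow> 'a"
    by (auto simp: invariant_colourings_def)
  then show ?case by simp
next
  case (insert a A)
  let ?N = "\<lambda>p. card (invariant_colourings A p K)"
  have "(\<Sum>p | p permutes insert a A. card (invariant_colourings (insert a A) p K)) =
      (\<Sum>b\<in>insert a A. \<Sum>p | p permutes A.
        card (invariant_colourings (insert a A) (transpose a b \<circ> p) K))"
    by (rule sum_over_permutations_insert) (use insert in auto)
  also have "\<dots> = (\<Sum>b\<in>insert a A. \<Sum>p | p permutes A. (if b = a then card K else 1) * ?N p)"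
    by (intro sum.cong refl card_invariant_colourings_insert) (use insert in auto)
  also have "\<dots> = (\<Sum>b\<in>insert a A. if b = a then card K else 1) * (\<Sum>p | p permutes A. ?N p)"
    by (simp only: sum_product)
  also have "(\<Sum>b\<in>insert a A. if b = a then card K else 1) = card K + card A"
  proof -
    have "(\<Sum>b\<in>A. if b = a then card K else 1) = (\<Sum>b\<in>A. 1)"
      by (rule sum.cong) (use insert in auto)
    then show ?thesis using insert by simp
  qed
  finally show ?case using insert by (simp add: pochhammer_Suc mult.commute)
qed

lemma cycle_index_sym_const:
  assumes "0 < k"
  shows "cycle_index_sym r (\<lambda>_. real k) = real ((r + k - 1) choose r)"
proof -
  have "(\<Prod>j = 1..r. real k ^ cycle_count {1..r} p j) =
      real (card (invariant_colourings {1..r} p {..<k}))"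
    if "p permutes {1..r}" for p
    using card_invariant_colourings[OF that, of "{..<k}"]
      card_cycles_eq_sum_cycle_count[of "{1..r}" r p] by (simp add: power_sum)
  then have "cycle_index_sym r (\<lambda>_. real k) =
      real (\<Sum>p | p permutes {1..r}. card (invariant_colourings {1..r} p {..<k})) / fact r"
    by (simp add: cycle_index_sym_def)
  also have "\<dots> = pochhammer (real k) r / fact r"
    by (simp add: sum_card_invariant_colourings pochhammer_of_nat)
  also have "\<dots> = real (r + k - 1) gchoose r"
    using assms by (simp add: gbinomial_pochhammer' of_nat_diff)
  finally show ?thesis by (simp add: binomial_gbinomial)
qed

section \<open>Graphs as multisets of neighbourhoods\<close>

definition neighbourhoods :: "'a bip_graph \<Rightarrow> 'a set multiset" where
  "neighbourhoods G = (case G of (I, W, E) \<Rightarrow> image_mset (\<lambda>w. {v \<in> I. (v, w) \<in> E}) (mset_set W))"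

text \<open>The permutation \<open>\<beta>\<close> of \<open>W\<close> only changes the order in which the neighbourhoods are listed, so it
  leaves no trace in the multiset.\<close>

lemma neighbourhoods_bip_iso:
  assumes "bip_iso (I, W, E) (I, W, E')"
  obtains \<alpha> where "\<alpha> permutes I"
    "neighbourhoods (I, W, E') = image_mset ((`) \<alpha>) (neighbourhoods (I, W, E))"
proof -
  obtain \<alpha> \<beta> where \<alpha>: "bij_betw \<alpha> I I" and \<beta>: "bij_betw \<beta> W W"
    and e: "\<And>v w. v \<in> I \<Longrightarrow> w \<in> W \<Longrightarrow> (\<alpha> v, \<beta> w) \<in> E' \<longleftrightarrow> (v, w) \<in> E"
    using assms by auto
  (* alpha is arbitrary outside I; the count needs a permutation that fixes everything there. *)
  define \<alpha>' where "\<alpha>' = restrict_id \<alpha> I"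
  have \<alpha>': "\<alpha>' permutes I"
    unfolding \<alpha>'_def using \<alpha> by (rule permutes_restrict_id)
  have img: "{u \<in> I. (u, \<beta> w) \<in> E'} = \<alpha>' ` {v \<in> I. (v, w) \<in> E}" if "w \<in> W" for w
  proof -
    have "{u \<in> I. (u, \<beta> w) \<in> E'} = \<alpha> ` {v \<in> I. (\<alpha> v, \<beta> w) \<in> E'}"
      using Compr_image_eq[of \<alpha> I "\<lambda>u. (u, \<beta> w) \<in> E'"] bij_betw_imp_surj_on[OF \<alpha>] by simp
    also have "{v \<in> I. (\<alpha> v, \<beta> w) \<in> E'} = {v \<in> I. (v, w) \<in> E}"
      using e that by blast
    also have "\<alpha> ` \<dots> = \<alpha>' ` \<dots>"
      by (rule image_cong) (simp_all add: \<alpha>'_def)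
    finally show ?thesis .
  qed
  have "mset_set W = image_mset \<beta> (mset_set W)"
    using \<beta> by (simp add: bij_betw_def image_mset_mset_set)
  then have "image_mset (\<lambda>w. {u \<in> I. (u, w) \<in> E'}) (mset_set W) =
      image_mset (\<lambda>w. {u \<in> I. (u, w) \<in> E'}) (image_mset \<beta> (mset_set W))"
    by (rule arg_cong)
  then have "neighbourhoods (I, W, E') = image_mset (\<lambda>w. {u \<in> I. (u, \<beta> w) \<in> E'}) (mset_set W)"
    by (simp add: neighbourhoods_def multiset.map_comp comp_def)
  also have "\<dots> = image_mset ((`) \<alpha>') (neighbourhoods (I, W, E))"
  proof (cases "finite W")
    case True
    then have "image_mset (\<lambda>w. {u \<in> I. (u, \<beta> w) \<in> E'}) (mset_set W) =
        image_mset (\<lambda>w. \<alpha>' ` {v \<in> I. (v, w) \<in> E}) (mset_set W)"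
      by (intro image_mset_cong img) simp
    then show ?thesis by (simp add: neighbourhoods_def multiset.map_comp comp_def)
  qed (simp add: neighbourhoods_def)
  finally show ?thesis using that \<alpha>' by blast
qed

lemma ex_image_mset_mset_set:
  assumes "finite W" "size M = card W"
  shows "\<exists>f. image_mset f (mset_set W) = M"
  using assms
proof (induction W arbitrary: M rule: finite_induct)
  case empty
  then show ?case by simp
next
  case (insert w W)
  then obtain x M' where M: "M = add_mset x M'" "size M' = card W"
    by (metis card_insert_disjoint size_eq_Suc_imp_eq_union size_add_mset nat.inject)
  then obtain f where f: "image_mset f (mset_set W) = M'" using insert.IH by blast
  have "image_mset (f(w := x)) (mset_set W) = image_mset f (mset_set W)"
    by (rule image_mset_cong) (use insert.hyps in auto)
  then have "image_mset (f(w := x)) (mset_set (insert w W)) = M"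
    using insert.hyps f M by simp
  then show ?case by blast
qed

lemma ex_graph_neighbourhoods:
  assumes "finite W" "M \<in> multisets_of_size (Pow I) (card W)"
  obtains G where "G \<in> bip_graphs I W" "neighbourhoods G = M"
proof -
  obtain f where f: "image_mset f (mset_set W) = M"
    using ex_image_mset_mset_set[OF assms(1)] multisets_of_size_size[OF assms(2)] by blast
  define E where "E = {(v, w). v \<in> f w \<and> w \<in> W}"
  have sub: "f w \<subseteq> I" if "w \<in> W" for w
    using that assms(1) multisets_of_size_subset[OF assms(2)]
    unfolding f[symmetric] by (simp add: image_subset_iff)
  have "(I, W, E) \<in> bip_graphs I W"
    using sub by (auto simp: bip_graphs_def E_def)
  moreover have "neighbourhoods (I, W, E) = image_mset f (mset_set W)"
    unfolding neighbourhoods_def prod.case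
    by (rule image_mset_cong) (use assms(1) sub in \<open>auto simp: E_def\<close>)
  ultimately show ?thesis using that f by blast
qed

text \<open>Every multiset of neighbourhoods is the image of that of a representative under a permutation of
  \<open>I\<close>, so pairs of a representative and a permutation cover all multisets.\<close>

lemma card_multisets_le_representatives:
  assumes I: "finite I" and W: "finite W" and B: "iso_representatives I W B"
  shows "(card W + 2 ^ card I - 1) choose card W \<le> card B * fact (card I)"
proof -
  let ?P = "{\<alpha>. \<alpha> permutes I}"
  let ?h = "\<lambda>(H, \<alpha>). image_mset ((`) \<alpha>) (neighbourhoods H)"
  have "bip_graphs I W = (\<lambda>E. (I, W, E)) ` Pow (I \<times> W)"
    by (auto simp: bip_graphs_def)
  then have "finite (bip_graphs I W)" using I W by simp
  then have finB: "finite B"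
    using B finite_subset unfolding iso_representatives_def by blast
  have "multisets_of_size (Pow I) (card W) \<subseteq> ?h ` (B \<times> ?P)"
  proof
    fix M assume "M \<in> multisets_of_size (Pow I) (card W)"
    then obtain G where G: "G \<in> bip_graphs I W" "neighbourhoods G = M"
      using ex_graph_neighbourhoods W by metis
    then obtain H where H: "H \<in> B" "bip_iso G H"
      using B unfolding iso_representatives_def by blast
    obtain E E' where E: "G = (I, W, E)" "H = (I, W, E')"
      using G H(1) B unfolding iso_representatives_def bip_graphs_def by blast
    obtain \<alpha> where "\<alpha> permutes I" "M = image_mset ((`) \<alpha>) (neighbourhoods H)"
      using neighbourhoods_bip_iso[of I W E' E] bip_iso_sym[OF H(2)] G(2) E by metis
    then show "M \<in> ?h ` (B \<times> ?P)" using H(1) by force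
  qed
  then have "card (multisets_of_size (Pow I) (card W)) \<le> card (B \<times> ?P)"
    using finB I by (intro surj_card_le) (auto intro: finite_permutations)
  then show ?thesis
    using I by (simp add: card_multisets_of_size card_Pow card_cartesian_product card_permutations add.commute)
qed

theorem theorem1:
  fixes n r :: nat and I W :: "'a set" and B :: "'a bip_graph set"
  assumes "0 < n" and "n < r"
    and "I \<inter> W = {}" and "card I = n" and "card W = r"
    and "iso_representatives I W B"
  shows "real (card B) \<ge> 1 / fact n * cycle_index_sym r (\<lambda>_. 2 ^ n)
       \<and> 1 / fact n * cycle_index_sym r (\<lambda>_. 2 ^ n) \<ge> real ((r + 2 ^ n - 1) choose r) / fact n"
proof -
  have "finite I" "finite W" using assms by (auto intro: card_ge_0_finite)
  then have "(r + 2 ^ n - 1) choose r \<le> card B * fact n"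
    using card_multisets_le_representatives[of I W B] assms by simp
  then have "real ((r + 2 ^ n - 1) choose r) \<le> real (card B) * fact n"
    by (metis of_nat_fact of_nat_le_iff of_nat_mult)
  moreover have "cycle_index_sym r (\<lambda>_. 2 ^ n) = real ((r + 2 ^ n - 1) choose r)"
    using cycle_index_sym_const[of "2 ^ n" r] by simp
  ultimately show ?thesis by (simp add: divide_le_eq)
qed

end
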